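(* Let $\{z^k\}_{k\ge 0}\subset\mathbb{R}^n$ be a sequence generated by the ALM algorithm (described in the context) applied to the SOCMPCC, with associated penalty parameters $\{\rho^k\}$. If $\{\rho^k\}$ is unbounded, then any limit point $z^*$ of $\{z^k\}$ is a stationary point (i.e. a point where the gradient of the objective vanishes) of the unconstrained problem $$\min_{z\in\mathbb{R}^n}\ \tfrac12\Big(\|g(z)_+\|^2+\|h(z)\|^2+\big(\langle G(z),H(z)\rangle_+\big)^2+\|\Pi_{\mathcal{K}^\circ}(G(z))\|^2+\|\Pi_{\mathcal{K}^\circ}(H(z))\|^2\Big).$$
   Context: **Problem.** Let $f:\mathbb{R}^n\to\mathbb{R}$, $g:\mathbb{R}^n\to\mathbb{R}^p$, $h:\mathbb{R}^n\to\mathbb{R}^q$, $G,H:\mathbb{R}^n\to\mathbb{R}^m$ be continuously differentiable. Let $m=\sum_{i=1}^J m_i$ and $\mathcal{K}=\mathcal{K}_1\times\cdots\times\mathcal{K}_J$, where $\mathcal{K}_i=\{(x_1,\bar x)\in\mathbb{R}\times\mathbb{R}^{m_i-1} : x_1\ge\|\bar x\|\}$ is the $m_i$-dimensional second-order cone ($\|\cdot\|$ Euclidean norm). The SOCMPCC is: minimize $f(z)$ subject to $g(z)\le 0$, $h(z)=0$, $G(z)\in\mathcal{K}$, $H(z)\in\mathcal{K}$, $G(z)^TH(z)=0$. **Notation.** $\mathcal{K}^\circ=\{w:\langle w,x\rangle\le 0\ \forall x\in\mathcal{K}\}=-\mathcal{K}$ is the polar cone; $\Pi_C$ is the Euclidean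 projection onto a closed convex set $C$; $a_+=\max\{a,0\}$, and $\max$, $\min$ of vectors are componentwise. A limit point of a sequence is the limit of some subsequence. **Augmented Lagrangian.** For $\rho>0$, $$\begin{aligned}L_\rho(z,\lambda,\mu,\eta,\Lambda,\Gamma)=\ &f(z)+\tfrac{\rho}{2}\|(g(z)+\tfrac{\lambda}{\rho})_+\|^2+\tfrac{\rho}{2}\|h(z)+\tfrac{\mu}{\rho}\|^2+\tfrac{\rho}{2}\big(\|\Pi_{\mathcal{K}^\circ}(G(z)+\tfrac{\Lambda}{\rho})\|^2-\|\tfrac{\Lambda}{\rho}\|^2\big)\\&+\tfrac{\rho}{2}\big(\|\Pi_{\mathcal{K}^\circ}(H(z)+\tfrac{\Gamma}{\rho})\|^2-\|\tfrac{\Gamma}{\rho}\|^2\big)+\tfrac{\rho}{2}\big((\langle G(z),H(z)\rangle+\tfrac{\eta}{\rho})_+\big)^2 .\end{aligned}$$ **ALM algorithm.** Data: a nonincreasing sequence $\epsilon_k>0$ with $\epsilon_k\to0$; a nonempty convex compact set $B\subseteq\mathcal{K}^\circ$; $\tau>1$, $\sigma\in(0,1)$, $\rho^0>0$, $\lambda_{\max}>0$, $\mu_{\min}<\mu_{\max}$, $\eta_{\min}<\eta_{\max}$; initial $\bar\lambda^0\in[0,\lambda_{\max}]^p$, $\bar\mu^0\in[\mu_{\min},\mu_{\max}]^q$, $\bar\eta^0\in[\eta_{\min},\eta_{\max}]$, $\bar\Lambda^0,\bar\Gamma^0\in B$. For $k=0,1,2,\dots$: Step 1. If $k>0$, let $(\bar\lambda^k,\bar\mu^k,\bar\eta^k)$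 be the projection of $(\lambda^k,\mu^k,\eta^k)$ onto $[0,\lambda_{\max}]^p\times[\mu_{\min},\mu_{\max}]^q\times[\eta_{\min},\eta_{\max}]$. Compute $z^k$ with $\|\nabla_zL_{\rho^k}(z^k,\bar\lambda^k,\bar\mu^k,\bar\eta^k,\bar\Lambda^k,\bar\Gamma^k)\|\le\epsilon_k$. Step 2. Set $\lambda^{k+1}=(\bar\lambda^k+\rho^kg(z^k))_+$, $\mu^{k+1}=\bar\mu^k+\rho^kh(z^k)$, $\eta^{k+1}=(\bar\eta^k+\rho^k\langle G(z^k),H(z^k)\rangle)_+$, $\Lambda^k=\rho^k\Pi_{\mathcal{K}^\circ}(G(z^k)+\bar\Lambda^k/\rho^k)$, $\Gamma^k=\rho^k\Pi_{\mathcal{K}^\circ}(H(z^k)+\bar\Gamma^k/\rho^k)$, $\bar\Lambda^{k+1}=\Pi_B(\Lambda^k)$, $\bar\Gamma^{k+1}=\Pi_B(\Gamma^k)$, $\zeta_{k+1}=\min\{\lambda^{k+1},-g(z^k)\}$, $\delta_{k+1}=\min\{\eta^{k+1},-\langle G(z^k),H(z^k)\rangle\}$, $V^k=\bar\Lambda^k/\rho^k-\Pi_{\mathcal{K}^\circ}(G(z^k)+\bar\Lambda^k/\rho^k)$, $U^k=\bar\Gamma^k/\rho^k-\Pi_{\mathcal{K}^\circ}(H(z^k)+\bar\Gamma^k/\rho^k)$. Step 3. If $k=0$, or if both $\max\{\|\zeta_{k+1}\|_\infty,|\delta_{k+1}|,\|h(z^k)\|_\infty\}\le\sigma\max\{\|\zeta_k\|_\infty,|\delta_k|,\|h(z^{k-1})\|_\infty\}$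 and [$\|V^k\|\le\sigma\|V^{k-1}\|$ and $\|U^k\|\le\sigma\|U^{k-1}\|$] hold, set $\rho^{k+1}=\rho^k$; otherwise set $\rho^{k+1}=\tau\rho^k$. A "sequence generated by the algorithm" is an infinite sequence $\{z^k\}$ obtained in this way. *)

theory Defs
  imports "HOL-Analysis.Analysis"
begin

definition cont_differentiable :: "('a::real_normed_vector \<Rightarrow> 'b::real_normed_vector) \<Rightarrow> bool" where
  "cont_differentiable F \<longleftrightarrow>
     (\<exists>F' :: 'a \<Rightarrow> 'a \<Rightarrow>\<^sub>L 'b.
        (\<forall>x. (F has_derivative blinfun_apply (F' x)) (at x)) \<and> continuous_on UNIV F')"

definition vec_pos :: "real ^ 'k \<Rightarrow> real ^ 'k" where
  "vec_pos v = (\<chi> i. max (v $ i) 0)"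

definition vec_min :: "real ^ 'k \<Rightarrow> real ^ 'k \<Rightarrow> real ^ 'k" where
  "vec_min v w = (\<chi> i. min (v $ i) (w $ i))"

text \<open>A vector of dimension d is given here by its components v 0, ..., v (d - 1).
  The distinguished coordinate is v 0, and L2_set is the Euclidean norm of the others.\<close>

definition second_order_cone :: "nat \<Rightarrow> (nat \<Rightarrow> real) set" where
  "second_order_cone d = {v. L2_set v {1..<d} \<le> v 0}"

text \<open>The coordinate set of \<open>real ^ 'm\<close> is split into J blocks of sizes ms 1, ..., ms J:
  idx j i names coordinate number i (counted from 0) of block j. In particular the sizes
  sum up to the number of coordinates.\<close>

definition block_structure :: "nat \<Rightarrow> (nat \<Rightarrow> nat) \<Rightarrow> (nat \<Rightarrow> nat \<Rightarrow> 'm::finite) \<Rightarrow> bool" where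
  "block_structure J ms idx \<longleftrightarrow>
     (\<forall>j\<in>{1..J}. 1 \<le> ms j) \<and>
     bij_betw (\<lambda>(j, i). idx j i) (SIGMA j:{1..J}. {..<ms j}) UNIV"

definition soc_product ::
    "nat \<Rightarrow> (nat \<Rightarrow> nat) \<Rightarrow> (nat \<Rightarrow> nat \<Rightarrow> 'm::finite) \<Rightarrow> (real ^ 'm) set" where
  "soc_product J ms idx =
     {x. \<forall>j\<in>{1..J}. (\<lambda>i. x $ idx j i) \<in> second_order_cone (ms j)}"

definition polar_cone :: "'a::real_inner set \<Rightarrow> 'a set" where
  "polar_cone K = {w. \<forall>x\<in>K. inner w x \<le> 0}"

definition aug_lagrangian ::
    "(real ^ 'm) set \<Rightarrow> (real ^ 'n \<Rightarrow> real) \<Rightarrow> (real ^ 'n \<Rightarrow> real ^ 'p) \<Rightarrow> (real ^ 'n \<Rightarrow> real ^ 'q) \<Rightarrow>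
     (real ^ 'n \<Rightarrow> real ^ 'm) \<Rightarrow> (real ^ 'n \<Rightarrow> real ^ 'm) \<Rightarrow> real \<Rightarrow>
     real ^ 'n \<Rightarrow> real ^ 'p \<Rightarrow> real ^ 'q \<Rightarrow> real \<Rightarrow> real ^ 'm \<Rightarrow> real ^ 'm \<Rightarrow> real" where
  "aug_lagrangian K f g h G H \<rho> z lam \<mu> \<eta> \<Lambda> \<Gamma> =
     f z
     + \<rho> / 2 * (norm (vec_pos (g z + lam /\<^sub>R \<rho>)))\<^sup>2
     + \<rho> / 2 * (norm (h z + \<mu> /\<^sub>R \<rho>))\<^sup>2
     + \<rho> / 2 * ((norm (closest_point (polar_cone K) (G z + \<Lambda> /\<^sub>R \<rho>)))\<^sup>2 - (norm (\<Lambda> /\<^sub>R \<rho>))\<^sup>2)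
     + \<rho> / 2 * ((norm (closest_point (polar_cone K) (H z + \<Gamma> /\<^sub>R \<rho>)))\<^sup>2 - (norm (\<Gamma> /\<^sub>R \<rho>))\<^sup>2)
     + \<rho> / 2 * (max (inner (G z) (H z) + \<eta> / \<rho>) 0)\<^sup>2"

definition infeasibility ::
    "(real ^ 'm) set \<Rightarrow> (real ^ 'n \<Rightarrow> real ^ 'p) \<Rightarrow> (real ^ 'n \<Rightarrow> real ^ 'q) \<Rightarrow>
     (real ^ 'n \<Rightarrow> real ^ 'm) \<Rightarrow> (real ^ 'n \<Rightarrow> real ^ 'm) \<Rightarrow> real ^ 'n \<Rightarrow> real" where
  "infeasibility K g h G H z =
     1 / 2 * ((norm (vec_pos (g z)))\<^sup>2 + (norm (h z))\<^sup>2 + (max (inner (G z) (H z)) 0)\<^sup>2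
       + (norm (closest_point (polar_cone K) (G z)))\<^sup>2
       + (norm (closest_point (polar_cone K) (H z)))\<^sup>2)"

end

theory Submission
  imports Defs
begin

text \<open>The squared positive part, the squared norm and the squared norm of the projection onto
  the polar cone all have the form \<open>norm (P y) ^ 2\<close> with \<open>P\<close> the projection onto a closed convex
  cone, and a product of such projections is again one. So the problem has a single constraint
  map \<open>\<Psi> = (g, h, \<langle>G, H\<rangle>, G, H)\<close>, with augmented Lagrangian
  \<open>f x + \<rho> / 2 * norm (P (\<Psi> x + a / \<rho>)) ^ 2\<close> up to a constant and infeasibility
  \<open>norm (P (\<Psi> x)) ^ 2 / 2\<close>. The gradient of \<open>norm (P y) ^ 2 / 2\<close> is \<open>P y\<close>. Dividing the
  approximate stationarity condition by \<open>\<rho>\<close> and letting \<open>\<rho>\<close> tend to infinity, the multipliers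
  \<open>a\<close> being bounded, gives \<open>\<langle>P (\<Psi> z), \<Psi>' z v\<rangle> = 0\<close> for all \<open>v\<close> at every limit point \<open>z\<close>.\<close>

text \<open>Moreau's characterization of the projection onto the closed convex cone \<open>range P\<close>.\<close>

definition cone_projection :: "('a::real_inner \<Rightarrow> 'a) \<Rightarrow> bool" where
  "cone_projection P \<longleftrightarrow>
     (\<forall>x. inner (x - P x) (P x) = 0) \<and> (\<forall>x y. inner (x - P x) (P y) \<le> 0)"

text \<open>The variational inequality of the projection, tested at the points
  \<open>2 *\<^sub>R ?P x\<close> and \<open>0\<close> of the cone, gives orthogonality of the
  residual to \<open>?P x\<close>; testing it at \<open>?P y\<close> then gives the sign
  condition.\<close>

lemma cone_projection_closest_point:
  fixes C :: "'a::euclidean_space set"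
  assumes "closed C" "convex C" "cone C" "0 \<in> C"
  shows "cone_projection (closest_point C)"
proof -
  let ?P = "closest_point C"
  have P: "?P x \<in> C" for x
    using assms by (intro closest_point_in_set) auto
  have dot: "inner (x - ?P x) (w - ?P x) \<le> 0" if "w \<in> C" for x w
    using closest_point_dot[OF assms(2,1) that] .
  have zero: "inner (x - ?P x) (?P x) = 0" for x
  proof (rule antisym)
    have "2 *\<^sub>R ?P x \<in> C"
      using \<open>cone C\<close> P unfolding cone_def by simp
    from dot[OF this, of x] show "inner (x - ?P x) (?P x) \<le> 0"
      by (simp add: inner_diff_right)
    from dot[OF \<open>0 \<in> C\<close>, of x] show "0 \<le> inner (x - ?P x) (?P x)"
      by simp
  qed
  moreover have "inner (x - ?P x) (?P y) \<le> 0" for x y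
    using dot[OF P, of x y] zero[of x] by (simp add: inner_diff_right)
  ultimately show ?thesis
    unfolding cone_projection_def by blast
qed

lemma cone_projection_polar_cone:
  fixes K :: "'a::euclidean_space set"
  shows "cone_projection (closest_point (polar_cone K))"
proof (rule cone_projection_closest_point)
  \<comment> \<open>As an intersection of closed half-spaces, the polar inherits closedness and
    convexity.\<close>
  have eq: "polar_cone K = (\<Inter>x\<in>K. {w. inner x w \<le> 0})"
    unfolding polar_cone_def by (auto simp: inner_commute)
  show "closed (polar_cone K)"
    unfolding eq by (intro closed_INT ballI closed_halfspace_le)
  show "convex (polar_cone K)"
    unfolding eq by (intro convex_INT convex_halfspace_le)
  show "cone (polar_cone K)"
    unfolding cone_def polar_cone_def by (simp add: mult_nonneg_nonpos)
qed (simp add: polar_cone_def)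

lemma cone_projection_vec_pos: "cone_projection vec_pos"
  unfolding cone_projection_def
proof (intro conjI allI)
  fix x y :: "real ^ 'k"
  show "inner (x - vec_pos x) (vec_pos x) = 0"
    unfolding inner_vec_def vec_pos_def by (intro sum.neutral) (auto simp: max_def)
  show "inner (x - vec_pos x) (vec_pos y) \<le> 0"
    unfolding inner_vec_def vec_pos_def
    by (intro sum_nonpos) (auto simp: max_def mult_nonpos_nonneg)
qed

lemma cone_projection_max: "cone_projection (\<lambda>x::real. max x 0)"
  unfolding cone_projection_def by (auto simp: max_def mult_nonpos_nonneg)

lemma cone_projection_id: "cone_projection (\<lambda>x. x)"
  unfolding cone_projection_def by simp

lemma cone_projection_map_prod:
  assumes "cone_projection P" "cone_projection Q"
  shows "cone_projection (map_prod P Q)"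
  using assms unfolding cone_projection_def
  by (auto simp: inner_prod_def intro!: add_nonpos_nonpos)

text \<open>Expanding the square leaves the cross terms \<open>inner (x - P x) (P y)\<close> and
  \<open>inner (y - P y) (P x)\<close>, which are nonpositive, and two diagonal terms, which vanish.
  Cauchy-Schwarz finishes after cancelling one factor \<open>norm (P x - P y)\<close>.\<close>

lemma cone_projection_nonexpansive:
  assumes "cone_projection P"
  shows "norm (P x - P y) \<le> norm (x - y)"
proof -
  have "(norm (P x - P y))\<^sup>2 =
      inner (x - y) (P x - P y) + inner (x - P x) (P y) + inner (y - P y) (P x)
        - inner (x - P x) (P x) - inner (y - P y) (P y)"
    unfolding power2_norm_eq_inner by (simp add: inner_diff inner_commute algebra_simps)
  also have "\<dots> \<le> inner (x - y) (P x - P y)"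
    using assms unfolding cone_projection_def by (simp add: add_nonpos_nonpos)
  also have "\<dots> \<le> norm (x - y) * norm (P x - P y)"
    by (rule norm_cauchy_schwarz)
  finally show ?thesis
    by (cases "P x = P y") (simp_all add: power2_eq_square)
qed

lemma continuous_on_cone_projection:
  assumes "cone_projection P"
  shows "continuous_on S P"
  unfolding continuous_on_iff dist_norm
  using cone_projection_nonexpansive[OF assms] by (meson le_less_trans)

text \<open>\<open>norm (P y) ^ 2 / 2\<close> is the maximum of \<open>\<langle>y, w\<rangle> - norm w ^ 2 / 2\<close> over \<open>w\<close> in \<open>range P\<close>,
  attained at \<open>w = P y\<close>, hence convex with subgradient \<open>P y\<close>.\<close>

lemma cone_projection_subgradient:
  assumes "cone_projection P"
  shows "(norm (P y))\<^sup>2 / 2 + inner (P y) (x - y) \<le> (norm (P x))\<^sup>2 / 2"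
proof -
  have "0 \<le> (norm (P x - P y))\<^sup>2 / 2"
    by simp
  also have "\<dots> = (norm (P x))\<^sup>2 / 2 - (norm (P y))\<^sup>2 / 2 - inner (P y) (x - y)
      + inner (x - P x) (P y) - inner (y - P y) (P y)"
    unfolding power2_norm_eq_inner by (simp add: inner_diff inner_commute field_simps)
  finally show ?thesis
    using assms unfolding cone_projection_def by (smt (verit))
qed

text \<open>The first-order remainder lies between 0 and \<open>norm (x - y) ^ 2\<close>: the
  subgradient inequality at \<open>y\<close> bounds it below, the one at \<open>x\<close> together
  with nonexpansiveness bounds it above.\<close>

lemma has_derivative_half_norm2_cone_projection:
  assumes "cone_projection P"
  shows "((\<lambda>y. (norm (P y))\<^sup>2 / 2) has_derivative (\<lambda>v. inner (P y) v)) (at y)"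
proof (rule has_derivativeI_sandwich[of 1 _ _ _ _ "\<lambda>x. norm (x - y)"])
  fix x assume "x \<noteq> y"
  let ?R = "(norm (P x))\<^sup>2 / 2 - (norm (P y))\<^sup>2 / 2 - inner (P y) (x - y)"
  have "0 \<le> ?R"
    using cone_projection_subgradient[OF assms, of y x] by simp
  moreover have "?R \<le> inner (P x - P y) (x - y)"
    using cone_projection_subgradient[OF assms, of x y] by (simp add: inner_diff algebra_simps)
  moreover have "\<dots> \<le> norm (x - y) * norm (x - y)"
    using norm_cauchy_schwarz[of "P x - P y" "x - y"]
      mult_right_mono[OF cone_projection_nonexpansive[OF assms, of x y] norm_ge_zero[of "x - y"]]
    by linarith
  ultimately show "norm ?R / norm (x - y) \<le> norm (x - y)"
    using \<open>x \<noteq> y\<close> by (simp add: pos_divide_le_eq)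
next
  show "((\<lambda>x. norm (x - y)) \<longlongrightarrow> 0) (at y)"
    by (intro tendsto_eq_intros) auto
qed (auto intro: bounded_linear_inner_right)

text \<open>Pointwise continuity of the derivative is all that the limit argument needs, and unlike
  \<^const>\<open>cont_differentiable\<close> it passes to pairs and inner products without \<open>blinfun\<close> arithmetic.\<close>

definition has_cont_derivative ::
    "('a::real_normed_vector \<Rightarrow> 'b::real_normed_vector) \<Rightarrow> ('a \<Rightarrow> 'a \<Rightarrow> 'b) \<Rightarrow> bool" where
  "has_cont_derivative F F' \<longleftrightarrow>
     (\<forall>x. (F has_derivative F' x) (at x)) \<and> (\<forall>v. continuous_on UNIV (\<lambda>x. F' x v))"

lemma cont_differentiableE:
  assumes "cont_differentiable F"
  obtains F' where "has_cont_derivative F F'"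
proof -
  from assms obtain F' :: "'a \<Rightarrow> 'a \<Rightarrow>\<^sub>L 'b"
    where F': "\<And>x. (F has_derivative blinfun_apply (F' x)) (at x)" "continuous_on UNIV F'"
    unfolding cont_differentiable_def by blast
  have "has_cont_derivative F (\<lambda>x. blinfun_apply (F' x))"
    unfolding has_cont_derivative_def by (auto intro!: F' continuous_intros)
  then show thesis
    by (rule that)
qed

lemma has_cont_derivative_imp_continuous_on:
  "has_cont_derivative F F' \<Longrightarrow> continuous_on S F"
  unfolding has_cont_derivative_def
  by (meson has_derivative_continuous continuous_at_imp_continuous_on)

lemma has_cont_derivative_Pair:
  assumes "has_cont_derivative F F'" "has_cont_derivative G G'"
  shows "has_cont_derivative (\<lambda>x. (F x, G x)) (\<lambda>x v. (F' x v, G' x v))"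
  using assms unfolding has_cont_derivative_def
  by (auto intro!: has_derivative_Pair continuous_on_Pair)

lemma has_cont_derivative_inner:
  assumes "has_cont_derivative F F'" "has_cont_derivative G G'"
  shows "has_cont_derivative (\<lambda>x. inner (F x) (G x))
    (\<lambda>x v. inner (F x) (G' x v) + inner (F' x v) (G x))"
  using assms has_cont_derivative_imp_continuous_on[OF assms(1), of UNIV]
    has_cont_derivative_imp_continuous_on[OF assms(2), of UNIV]
  unfolding has_cont_derivative_def
  by (auto intro!: has_derivative_inner continuous_intros)

lemma has_derivative_half_norm2_cone_projection_compose:
  assumes "cone_projection P" "has_cont_derivative F F'"
  shows "((\<lambda>x. (norm (P (F x + b)))\<^sup>2 / 2) has_derivative (\<lambda>v. inner (P (F x + b)) (F' x v))) (at x)"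
proof -
  have "((\<lambda>x. F x + b) has_derivative F' x) (at x)"
    using assms(2) unfolding has_cont_derivative_def by (simp add: has_derivative_add_const)
  then show ?thesis
    using has_derivative_compose has_derivative_half_norm2_cone_projection[OF assms(1)] by blast
qed

text \<open>The derivative at \<open>z k\<close> in direction \<open>v\<close>, divided by
  \<open>\<rho> k\<close>, expresses the penalty part as a convergent numerator over a divergent
  \<open>\<rho> k\<close>. Here \<open>b k\<close> plays the scaled multiplier and
  \<open>c k\<close> collects terms independent of \<open>x\<close>.\<close>

lemma penalty_limit_stationary:
  fixes F :: "'a::real_inner \<Rightarrow> 'b::real_inner"
  assumes P: "cone_projection P"
    and f: "has_cont_derivative f f'" and F: "has_cont_derivative F F'"
    and D: "\<And>k. GDERIV (\<lambda>x. f x + \<rho> k * ((norm (P (F x + b k)))\<^sup>2 / 2) + c k) (z k) :> D k"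
    and "D \<longlonglongrightarrow> 0" "b \<longlonglongrightarrow> 0" "z \<longlonglongrightarrow> z'" and \<rho>: "filterlim \<rho> at_top sequentially"
  shows "GDERIV (\<lambda>x. (norm (P (F x)))\<^sup>2 / 2) z' :> 0"
proof -
  have "inner (P (F z')) (F' z' v) = 0" for v
  proof -
    have "inner v (D k) = f' (z k) v + \<rho> k * inner (P (F (z k) + b k)) (F' (z k) v)" for k
    proof -
      have "(f has_derivative f' (z k)) (at (z k))"
        using f unfolding has_cont_derivative_def by blast
      from has_derivative_add_const[OF has_derivative_add[OF this has_derivative_mult_right[OF
            has_derivative_half_norm2_cone_projection_compose[OF P F]]]]
      show ?thesis
        using D[of k] unfolding gderiv_def by (blast dest: has_derivative_unique fun_cong)
    qed
    \<comment> \<open>Divergence of \<open>\<rho>\<close> excludes zero values only eventually,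
      hence the guard; \<open>Lim_transform_eventually\<close> discharges it below.\<close>
    then have *: "inner (P (F (z k) + b k)) (F' (z k) v) = (inner v (D k) - f' (z k) v) / \<rho> k"
      if "\<rho> k \<noteq> 0" for k
      using that by simp
    have f'v: "continuous_on UNIV (\<lambda>x. f' x v)" and F'v: "continuous_on UNIV (\<lambda>x. F' x v)"
      using f F unfolding has_cont_derivative_def by blast+
    have "(\<lambda>k. F (z k) + b k) \<longlonglongrightarrow> F z' + 0"
      using continuous_on_tendsto_compose[OF has_cont_derivative_imp_continuous_on[OF F, of UNIV] \<open>z \<longlonglongrightarrow> z'\<close>]
        \<open>b \<longlonglongrightarrow> 0\<close> by (intro tendsto_add) auto
    from continuous_on_tendsto_compose[OF continuous_on_cone_projection[OF P, of UNIV] this]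
    have "(\<lambda>k. inner (P (F (z k) + b k)) (F' (z k) v)) \<longlonglongrightarrow> inner (P (F z')) (F' z' v)"
      using continuous_on_tendsto_compose[OF F'v \<open>z \<longlonglongrightarrow> z'\<close>] by (auto intro: tendsto_inner)
    moreover have "(\<lambda>k. (inner v (D k) - f' (z k) v) / \<rho> k) \<longlonglongrightarrow> 0"
    proof (rule real_tendsto_divide_at_top[OF _ \<rho>])
      show "(\<lambda>k. inner v (D k) - f' (z k) v) \<longlonglongrightarrow> inner v 0 - f' z' v"
        using continuous_on_tendsto_compose[OF f'v \<open>z \<longlonglongrightarrow> z'\<close>] \<open>D \<longlonglongrightarrow> 0\<close>
        by (intro tendsto_intros) auto
    qed
    then have "(\<lambda>k. inner (P (F (z k) + b k)) (F' (z k) v)) \<longlonglongrightarrow> 0"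
    proof (rule Lim_transform_eventually)
      have "\<forall>\<^sub>F k in sequentially. \<rho> k > 0"
        using \<rho> unfolding filterlim_at_top_dense by blast
      then show "\<forall>\<^sub>F k in sequentially. (inner v (D k) - f' (z k) v) / \<rho> k =
          inner (P (F (z k) + b k)) (F' (z k) v)"
        by eventually_elim (simp add: *)
    qed
    ultimately show ?thesis
      by (rule LIMSEQ_unique)
  qed
  then show ?thesis
    using has_derivative_half_norm2_cone_projection_compose[OF P F, of 0 z']
    unfolding gderiv_def by simp
qed

theorem theorem3p2:
  fixes f :: "real ^ 'n \<Rightarrow> real"
    and g :: "real ^ 'n \<Rightarrow> real ^ 'p"
    and h :: "real ^ 'n \<Rightarrow> real ^ 'q"
    and G H :: "real ^ 'n \<Rightarrow> real ^ 'm"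
    and J :: nat and ms :: "nat \<Rightarrow> nat" and idx :: "nat \<Rightarrow> nat \<Rightarrow> 'm"
    and K B :: "(real ^ 'm) set"
    and \<epsilon> :: "nat \<Rightarrow> real"
    and \<tau> \<sigma> \<rho>0 lam_max \<mu>_min \<mu>_max \<eta>_min \<eta>_max :: real
    and z :: "nat \<Rightarrow> real ^ 'n" and \<rho> :: "nat \<Rightarrow> real"
    and lam lam_bar :: "nat \<Rightarrow> real ^ 'p"
    and \<mu> \<mu>_bar :: "nat \<Rightarrow> real ^ 'q"
    and \<eta> \<eta>_bar :: "nat \<Rightarrow> real"
    and \<Lambda> \<Lambda>_bar \<Gamma> \<Gamma>_bar V U :: "nat \<Rightarrow> real ^ 'm"
    and \<zeta> :: "nat \<Rightarrow> real ^ 'p" and \<delta> :: "nat \<Rightarrow> real"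
    and z_star :: "real ^ 'n" and r :: "nat \<Rightarrow> nat"
  assumes smooth: "cont_differentiable f" "cont_differentiable g" "cont_differentiable h"
      "cont_differentiable G" "cont_differentiable H"
    and blocks: "block_structure J ms idx"
    and K: "K = soc_product J ms idx"
    and eps: "decseq \<epsilon>" "\<And>k. \<epsilon> k > 0" "\<epsilon> \<longlonglongrightarrow> 0"
    and B: "B \<noteq> {}" "convex B" "compact B" "B \<subseteq> polar_cone K"
    and params: "\<tau> > 1" "0 < \<sigma>" "\<sigma> < 1" "\<rho>0 > 0" "lam_max > 0" "\<mu>_min < \<mu>_max" "\<eta>_min < \<eta>_max"
    and init: "lam_bar 0 \<in> cbox (vec 0) (vec lam_max)" "\<mu>_bar 0 \<in> cbox (vec \<mu>_min) (vec \<mu>_max)"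
      "\<eta>_bar 0 \<in> {\<eta>_min..\<eta>_max}" "\<Lambda>_bar 0 \<in> B" "\<Gamma>_bar 0 \<in> B" "\<rho> 0 = \<rho>0"
    and step1_multipliers: "\<And>k. k > 0 \<Longrightarrow> (lam_bar k, \<mu>_bar k, \<eta>_bar k) =
        closest_point
          (cbox (vec 0) (vec lam_max) \<times> cbox (vec \<mu>_min) (vec \<mu>_max) \<times> {\<eta>_min..\<eta>_max})
          (lam k, \<mu> k, \<eta> k)"
    and step1_z: "\<And>k. \<exists>D.
        GDERIV (\<lambda>x. aug_lagrangian K f g h G H (\<rho> k) x
          (lam_bar k) (\<mu>_bar k) (\<eta>_bar k) (\<Lambda>_bar k) (\<Gamma>_bar k)) (z k) :> D
        \<and> norm D \<le> \<epsilon> k"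
    and step2_lam: "\<And>k. lam (Suc k) = vec_pos (lam_bar k + \<rho> k *\<^sub>R g (z k))"
    and step2_mu: "\<And>k. \<mu> (Suc k) = \<mu>_bar k + \<rho> k *\<^sub>R h (z k)"
    and step2_eta: "\<And>k. \<eta> (Suc k) = max (\<eta>_bar k + \<rho> k * inner (G (z k)) (H (z k))) 0"
    and step2_Lambda: "\<And>k. \<Lambda> k =
        \<rho> k *\<^sub>R closest_point (polar_cone K) (G (z k) + \<Lambda>_bar k /\<^sub>R \<rho> k)"
    and step2_Gamma: "\<And>k. \<Gamma> k =
        \<rho> k *\<^sub>R closest_point (polar_cone K) (H (z k) + \<Gamma>_bar k /\<^sub>R \<rho> k)"
    and step2_Lambda_bar: "\<And>k. \<Lambda>_bar (Suc k) = closest_point B (\<Lambda> k)"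
    and step2_Gamma_bar: "\<And>k. \<Gamma>_bar (Suc k) = closest_point B (\<Gamma> k)"
    and step2_zeta: "\<And>k. \<zeta> (Suc k) = vec_min (lam (Suc k)) (- g (z k))"
    and step2_delta: "\<And>k. \<delta> (Suc k) = min (\<eta> (Suc k)) (- inner (G (z k)) (H (z k)))"
    and step2_V: "\<And>k. V k =
        \<Lambda>_bar k /\<^sub>R \<rho> k - closest_point (polar_cone K) (G (z k) + \<Lambda>_bar k /\<^sub>R \<rho> k)"
    and step2_U: "\<And>k. U k =
        \<Gamma>_bar k /\<^sub>R \<rho> k - closest_point (polar_cone K) (H (z k) + \<Gamma>_bar k /\<^sub>R \<rho> k)"
    and step3: "\<And>k. \<rho> (Suc k) =
        (if k = 0 \<or>
            (Max {infnorm (\<zeta> (Suc k)), \<bar>\<delta> (Suc k)\<bar>, infnorm (h (z k))}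
               \<le> \<sigma> * Max {infnorm (\<zeta> k), \<bar>\<delta> k\<bar>, infnorm (h (z (k - 1)))}
             \<and> norm (V k) \<le> \<sigma> * norm (V (k - 1))
             \<and> norm (U k) \<le> \<sigma> * norm (U (k - 1)))
         then \<rho> k else \<tau> * \<rho> k)"
    and unbounded: "\<not> bounded (range \<rho>)"
    and limit_point: "strict_mono r" "(z \<circ> r) \<longlonglongrightarrow> z_star"
  shows "GDERIV (infeasibility K g h G H) z_star :> 0"
proof -
  \<comment> \<open>The factors follow the components of \<open>\<Psi>\<close>. The identity, as
    projection onto the whole space, penalizes the equality residual in full.\<close>
  define P :: "(real ^ 'p) \<times> (real ^ 'q) \<times> real \<times> (real ^ 'm) \<times> (real ^ 'm) \<Rightarrow> _" where
    "P = map_prod vec_pos (map_prod (\<lambda>y. y) (map_prod (\<lambda>t. max t 0)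
       (map_prod (closest_point (polar_cone K)) (closest_point (polar_cone K)))))"
  define \<Psi> where "\<Psi> x = (g x, h x, inner (G x) (H x), G x, H x)" for x
  define a where "a k = (lam_bar k, \<mu>_bar k, \<eta>_bar k, \<Lambda>_bar k, \<Gamma>_bar k)" for k
  have P: "cone_projection P"
    unfolding P_def
    by (intro cone_projection_map_prod cone_projection_vec_pos cone_projection_id
        cone_projection_max cone_projection_polar_cone)
  have P_norm2: "(norm (P (x1, x2, x3, x4, x5)))\<^sup>2 =
      (norm (vec_pos x1))\<^sup>2 + (norm x2)\<^sup>2 + (max x3 0)\<^sup>2
      + (norm (closest_point (polar_cone K) x4))\<^sup>2 + (norm (closest_point (polar_cone K) x5))\<^sup>2"
    for x1 x2 x3 x4 x5
    by (simp add: P_def norm_Pair)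
  obtain f' where f: "has_cont_derivative f f'"
    using smooth(1) by (rule cont_differentiableE)
  obtain g' h' G' H' where "has_cont_derivative g g'" "has_cont_derivative h h'"
      "has_cont_derivative G G'" "has_cont_derivative H H'"
    using smooth(2-) by (metis cont_differentiableE)
  then have "\<exists>\<Psi>'. has_cont_derivative \<Psi> \<Psi>'"
    unfolding \<Psi>_def by - (rule exI, (rule has_cont_derivative_Pair has_cont_derivative_inner | assumption)+)
  then obtain \<Psi>' where \<Psi>: "has_cont_derivative \<Psi> \<Psi>'" ..
  obtain D where D: "\<And>k. GDERIV (\<lambda>x. aug_lagrangian K f g h G H (\<rho> k) x
          (lam_bar k) (\<mu>_bar k) (\<eta>_bar k) (\<Lambda>_bar k) (\<Gamma>_bar k)) (z k) :> D k"
      and D_le: "\<And>k. norm (D k) \<le> \<epsilon> k"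
    using step1_z by metis

  have pos: "\<rho> k > 0" for k
    by (induction k) (use init params step3 in auto)
  have "\<rho> k \<le> \<rho> (Suc k)" for k
    using step3[of k] pos[of k] params by auto
  then have "incseq \<rho>"
    by (rule incseq_SucI)
  \<comment> \<open>A monotone unbounded sequence diverges; positivity makes unboundedness in
    absolute value mean that no upper bound exists.\<close>
  have \<rho>: "filterlim \<rho> at_top sequentially"
    unfolding filterlim_at_top
  proof
    fix M
    obtain n where "M \<le> \<rho> n"
      using unbounded pos unfolding bounded_iff
      by (metis abs_of_pos linorder_le_cases rangeE real_norm_def)
    then show "\<forall>\<^sub>F k in sequentially. M \<le> \<rho> k"
      using \<open>incseq \<rho>\<close> unfolding eventually_sequentially
      by (meson incseqD order_trans)
  qed

  define S :: "((real ^ 'p) \<times> (real ^ 'q) \<times> real) set" where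
    "S = cbox (vec 0) (vec lam_max) \<times> cbox (vec \<mu>_min) (vec \<mu>_max) \<times> {\<eta>_min..\<eta>_max}"
  have "closed S"
    unfolding S_def by (intro closed_Times closed_cbox closed_real_atLeastAtMost)
  \<comment> \<open>This settles \<open>k = 0\<close> and also witnesses that \<open>S\<close> is
    nonempty, without which the later projections need not land in \<open>S\<close>.\<close>
  have "(lam_bar 0, \<mu>_bar 0, \<eta>_bar 0) \<in> S"
    using init by (simp add: S_def)
  then have S: "(lam_bar k, \<mu>_bar k, \<eta>_bar k) \<in> S" for k
    using step1_multipliers[of k, folded S_def] closest_point_in_set[OF \<open>closed S\<close>]
    by (cases "k = 0") auto
  have "closest_point B x \<in> B" for x
    using B by (intro closest_point_in_set compact_imp_closed) auto
  then have B': "\<Lambda>_bar k \<in> B" "\<Gamma>_bar k \<in> B" for k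
    using init step2_Lambda_bar step2_Gamma_bar by (metis not0_implies_Suc)+
  \<comment> \<open>The safeguarding boxes and the compact set \<open>B\<close> confine all
    multipliers to one bounded set, so dividing by \<open>\<rho> k\<close> sends them to 0.\<close>
  have "range a \<subseteq> cbox (vec 0) (vec lam_max) \<times> cbox (vec \<mu>_min) (vec \<mu>_max) \<times>
      {\<eta>_min..\<eta>_max} \<times> B \<times> B"
    using S B' unfolding S_def a_def by auto
  then have "bounded (range a)"
    by (rule bounded_subset[rotated])
      (intro bounded_Times bounded_cbox bounded_closed_interval compact_imp_bounded[OF B(3)])
  then have "Bseq a"
    by (simp add: Bseq_eq_bounded)
  have "(\<lambda>k. a k /\<^sub>R \<rho> k) \<longlonglongrightarrow> 0"
  proof -
    have "Zfun (\<lambda>k. inverse (\<rho> k)) sequentially"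
      using tendsto_inverse_0_at_top[OF \<rho>] by (simp add: tendsto_Zfun_iff)
    from bounded_bilinear.Zfun_prod_Bfun[OF bounded_bilinear_scaleR this \<open>Bseq a\<close>]
    show ?thesis
      by (simp add: tendsto_Zfun_iff)
  qed
  then have b_lim: "(\<lambda>k. a (r k) /\<^sub>R \<rho> (r k)) \<longlonglongrightarrow> 0"
    using LIMSEQ_subseq_LIMSEQ[OF _ limit_point(1)] by (auto simp: comp_def)
  have "D \<longlonglongrightarrow> 0"
    using D_le by (intro Lim_null_comparison[OF _ eps(3)]) simp
  then have D_lim: "(\<lambda>k. D (r k)) \<longlonglongrightarrow> 0"
    using LIMSEQ_subseq_LIMSEQ[OF _ limit_point(1)] by (auto simp: comp_def)
  have \<rho>_lim: "filterlim (\<lambda>k. \<rho> (r k)) at_top sequentially"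
    by (rule filterlim_compose[OF \<rho> filterlim_subseq[OF limit_point(1)]])
  have z_lim: "(\<lambda>k. z (r k)) \<longlonglongrightarrow> z_star"
    using limit_point(2) by (simp add: comp_def)
  \<comment> \<open>These are the subtracted squares of the Lagrangian, constant in the variable of
    differentiation.\<close>
  define c where
    "c k = - \<rho> k / 2 * ((norm (\<Lambda>_bar k /\<^sub>R \<rho> k))\<^sup>2 + (norm (\<Gamma>_bar k /\<^sub>R \<rho> k))\<^sup>2)" for k
  have "aug_lagrangian K f g h G H (\<rho> k) x
          (lam_bar k) (\<mu>_bar k) (\<eta>_bar k) (\<Lambda>_bar k) (\<Gamma>_bar k) =
      f x + \<rho> k * ((norm (P (\<Psi> x + a k /\<^sub>R \<rho> k)))\<^sup>2 / 2) + c k" for k x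
  proof -
    \<comment> \<open>The squared norm on the product splits into five squares, so only a regrouping
      of reals remains. \<open>u3\<close> stands last on the left because the Lagrangian lists the
      complementarity term last, whereas \<open>\<Psi>\<close> has it third.\<close>
    have "y + t / 2 * u1 + t / 2 * u2 + t / 2 * (u4 - v4) + t / 2 * (u5 - v5) + t / 2 * u3 =
        y + t * ((u1 + u2 + u3 + u4 + u5) / 2) + - t / 2 * (v4 + v5)"
      for y t u1 u2 u3 u4 u5 v4 v5 :: real
      by (simp add: field_simps)
    then show ?thesis
      unfolding aug_lagrangian_def \<Psi>_def a_def c_def scaleR_Pair add_Pair P_norm2
        real_scaleR_def divide_inverse_commute[symmetric] .
  qed
  note D[unfolded this]
  \<comment> \<open>All sequences are taken along \<open>r\<close>, where \<open>z\<close>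
    converges.\<close>
  from penalty_limit_stationary[OF P f \<Psi> this D_lim b_lim z_lim \<rho>_lim]
  show ?thesis
    unfolding infeasibility_def \<Psi>_def P_norm2 by simp
qed

end
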